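(* Let $\mathbb{F}$ be a field and let $f \in \mathbb{F}[x_1,\dots,x_n]$ be a homogeneous $n$-variate polynomial of degree $d$ that is computed by a homogeneous arithmetic formula of size $s$. Then for any $0 < t \leq d$, $f$ can be equivalently computed by a homogeneous $\Sigma\Pi^{[a]}\Sigma\Pi^{[t]}$ formula of top fan-in at most $s^{10(d/t)}$, where \[ a > \frac{1}{10}\cdot\frac{d}{t}\cdot \log t. \]
   Context: A homogeneous formula (or circuit) is one in which every gate computes a homogeneous polynomial. A $\Sigma\Pi\Sigma\Pi^{[t]}$ formula is a depth-four formula with an addition gate at the output, whose children are multiplication gates, whose children are addition gates, whose children are multiplication gates of fan-in at most $t$ whose inputs are variables or field constants. A $\Sigma\Pi^{[a]}\Sigma\Pi^{[t]}$ formula is a $\Sigma\Pi\Sigma\Pi^{[t]}$ formula with the additional property that every multiplication gate adjacent to the output gate has fan-in at least $a$, i.e., the polynomial computed at each such gate is a product of at least $a$ non-trivial (non-constant) factors. The top fan-in is the fan-in of the output addition gate. *)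

theory Defs
  imports Complex_Main "HOL-Library.Poly_Mapping"
begin

(* Monomials are exponent vectors; the variable x_{i+1} has index i, so that
   F[x_1,...,x_n] is the set of polynomials with variable indices in {..<n}. *)
type_synonym 'a mpoly = "(nat \<Rightarrow>\<^sub>0 nat) \<Rightarrow>\<^sub>0 'a"

definition poly_const :: "'a::zero \<Rightarrow> 'a mpoly" where
  "poly_const c = Poly_Mapping.single 0 c"

definition poly_var :: "nat \<Rightarrow> 'a::zero_neq_one mpoly" where
  "poly_var i = Poly_Mapping.single (Poly_Mapping.single i 1) 1"

definition poly_vars :: "'a::zero mpoly \<Rightarrow> nat set" where
  "poly_vars p = (\<Union>m \<in> Poly_Mapping.keys p. Poly_Mapping.keys m)"

definition mono_degree :: "(nat \<Rightarrow>\<^sub>0 nat) \<Rightarrow> nat" where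
  "mono_degree m = (\<Sum>i \<in> Poly_Mapping.keys m. Poly_Mapping.lookup m i)"

(* The zero polynomial counts as homogeneous of every degree. *)
definition homogeneous_poly :: "nat \<Rightarrow> 'a::zero mpoly \<Rightarrow> bool" where
  "homogeneous_poly d p \<longleftrightarrow> (\<forall>m \<in> Poly_Mapping.keys p. mono_degree m = d)"

definition constant_poly :: "'a::zero mpoly \<Rightarrow> bool" where
  "constant_poly p \<longleftrightarrow> (\<exists>c. p = poly_const c)"

(* Gates have unbounded fan-in; fan-in 0 is allowed and gives the empty sum 0
   or the empty product 1. *)
datatype 'a formula =
    Var nat
  | Const 'a
  | Add "'a formula list"
  | Mul "'a formula list"

primrec formula_poly :: "'a::field formula \<Rightarrow> 'a mpoly" where
  "formula_poly (Var i) = poly_var i"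
| "formula_poly (Const c) = poly_const c"
| "formula_poly (Add fs) = sum_list (map formula_poly fs)"
| "formula_poly (Mul fs) = prod_list (map formula_poly fs)"

(* Input gates (leaves) are gates too: they count towards the size. *)
primrec formula_size :: "'a formula \<Rightarrow> nat" where
  "formula_size (Var i) = 1"
| "formula_size (Const c) = 1"
| "formula_size (Add fs) = 1 + sum_list (map formula_size fs)"
| "formula_size (Mul fs) = 1 + sum_list (map formula_size fs)"

primrec gates :: "'a formula \<Rightarrow> 'a formula set" where
  "gates (Var i) = {Var i}"
| "gates (Const c) = {Const c}"
| "gates (Add fs) = insert (Add fs) (\<Union> (set (map gates fs)))"
| "gates (Mul fs) = insert (Mul fs) (\<Union> (set (map gates fs)))"

definition formula_vars :: "'a formula \<Rightarrow> nat set" where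
  "formula_vars \<phi> = {i. Var i \<in> gates \<phi>}"

definition homogeneous_formula :: "'a::field formula \<Rightarrow> bool" where
  "homogeneous_formula \<phi> \<longleftrightarrow> (\<forall>g \<in> gates \<phi>. \<exists>e. homogeneous_poly e (formula_poly g))"

fun is_input :: "'a formula \<Rightarrow> bool" where
  "is_input (Var i) = True"
| "is_input (Const c) = True"
| "is_input (Add fs) = False"
| "is_input (Mul fs) = False"

fun is_Add :: "'a formula \<Rightarrow> bool" where
  "is_Add (Add fs) = True"
| "is_Add \<phi> = False"

fun is_Mul :: "'a formula \<Rightarrow> bool" where
  "is_Mul (Mul fs) = True"
| "is_Mul \<phi> = False"

fun children :: "'a formula \<Rightarrow> 'a formula list" where
  "children (Var i) = []"
| "children (Const c) = []"
| "children (Add fs) = fs"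
| "children (Mul fs) = fs"

definition fan_in :: "'a formula \<Rightarrow> nat" where
  "fan_in \<phi> = length (children \<phi>)"

(* Constants among the inputs of a bottom multiplication gate count towards
   its fan-in. *)
definition SPSP :: "nat \<Rightarrow> 'a formula \<Rightarrow> bool" where
  "SPSP t \<phi> \<longleftrightarrow>
     is_Add \<phi> \<and>
     (\<forall>p \<in> set (children \<phi>). is_Mul p \<and>
       (\<forall>q \<in> set (children p). is_Add q \<and>
         (\<forall>r \<in> set (children q). is_Mul r \<and> fan_in r \<le> t \<and>
           (\<forall>l \<in> set (children r). is_input l))))"

(* Only the factors that compute a non-constant polynomial count towards a. *)
definition SPaSP :: "nat \<Rightarrow> nat \<Rightarrow> 'a::field formula \<Rightarrow> bool" where
  "SPaSP a t \<phi> \<longleftrightarrow>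
     SPSP t \<phi> \<and>
     (\<forall>p \<in> set (children \<phi>).
       a \<le> length (filter (\<lambda>q. \<not> constant_poly (formula_poly q)) (children p)))"

end

theory Submission
  imports Defs
begin

text \<open>
  A polynomial of degree \<open>d\<close> with a homogeneous formula of size \<open>s\<close> is a sum of at most \<open>s\<close> products of
  polynomials with such formulas, the degrees in each product decreasing geometrically (the
  log-product decomposition of Hrubes and Yehudayoff). Expand every factor of degree at least \<open>t\<close> in
  this way until none is left. Each expansion splits off degree of order \<open>t\<close>, so a product of the
  result comes from at most \<open>2d/t - 1\<close> expansions, which bounds the top fan-in by \<open>s^(2d/t - 1)\<close>; and each
  stretch of degree \<open>3t\<close> contributes the \<open>1 + (log t)/2\<close> factors of the tail of a chain. All factors
  have degree at least 1 and less than \<open>t\<close>, which leaves one input of a bottom gate for the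
  coefficient. This fails for \<open>t = 1\<close>, where the expansion into at most \<open>s^d\<close> monomials is used.
\<close>

subsection \<open>Homogeneous computations\<close>

lemma mono_degree_superset:
  assumes "finite A" "Poly_Mapping.keys m \<subseteq> A"
  shows "mono_degree m = (\<Sum>i\<in>A. Poly_Mapping.lookup m i)"
  unfolding mono_degree_def using assms
  by (intro sum.mono_neutral_left) (auto simp: in_keys_iff)

lemma mono_degree_add: "mono_degree (m + m') = mono_degree m + mono_degree m'"
proof -
  let ?A = "Poly_Mapping.keys m \<union> Poly_Mapping.keys m'"
  have "mono_degree (m + m') = (\<Sum>i\<in>?A. Poly_Mapping.lookup (m + m') i)"
    using keys_add[of m m'] by (intro mono_degree_superset) auto
  also have "\<dots> = mono_degree m + mono_degree m'"
    by (simp add: lookup_add sum.distrib mono_degree_superset[of ?A])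
  finally show ?thesis .
qed

lemma mono_degree_0 [simp]: "mono_degree 0 = 0"
  by (simp add: mono_degree_def)

lemma mono_degree_single [simp]: "mono_degree (Poly_Mapping.single i k) = k"
  by (simp add: mono_degree_def)

text \<open>\<open>0\<close> satisfies this for every \<open>e\<close>, so it is preserved by
  addition even where terms cancel.\<close>

definition form_on :: "nat set \<Rightarrow> nat \<Rightarrow> 'a::zero mpoly \<Rightarrow> bool" where
  "form_on V e p \<longleftrightarrow> homogeneous_poly e p \<and> poly_vars p \<subseteq> V"

lemma form_on_0 [simp]: "form_on V e 0"
  by (simp add: form_on_def homogeneous_poly_def poly_vars_def)

lemma form_on_const [simp]: "form_on V 0 (poly_const c)"
  by (simp add: form_on_def homogeneous_poly_def poly_vars_def poly_const_def)

lemma form_on_var: "i \<in> V \<Longrightarrow> form_on V 1 (poly_var i)"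
  by (simp add: form_on_def homogeneous_poly_def poly_vars_def poly_var_def)

lemma form_on_add:
  fixes p q :: "'a::comm_monoid_add mpoly"
  assumes "form_on V e p" "form_on V e q"
  shows "form_on V e (p + q)"
  using assms keys_add[of p q]
  unfolding form_on_def homogeneous_poly_def poly_vars_def by blast

lemma form_on_mult:
  fixes p q :: "'a::semiring_0 mpoly"
  assumes "form_on V e p" "form_on V e' q"
  shows "form_on V (e + e') (p * q)"
proof -
  have "mono_degree m = e + e' \<and> Poly_Mapping.keys m \<subseteq> V"
    if "m \<in> Poly_Mapping.keys (p * q)" for m
  proof -
    from that obtain a b where ab: "m = a + b" "a \<in> Poly_Mapping.keys p" "b \<in> Poly_Mapping.keys q"
      using keys_mult[of p q] by blast
    then have "Poly_Mapping.keys a \<subseteq> V" "Poly_Mapping.keys b \<subseteq> V"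
      "mono_degree a = e" "mono_degree b = e'"
      using assms by (auto simp: form_on_def homogeneous_poly_def poly_vars_def)
    then show ?thesis
      using keys_add[of a b] by (auto simp: ab(1) mono_degree_add)
  qed
  then show ?thesis
    by (auto simp: form_on_def homogeneous_poly_def poly_vars_def)
qed

lemma poly_const_1: "poly_const 1 = 1"
  by (simp add: poly_const_def)

lemma homogeneous_poly_unique:
  assumes "p \<noteq> 0" "homogeneous_poly d p" "homogeneous_poly e p"
  shows "d = e"
proof -
  from assms(1) obtain m where "m \<in> Poly_Mapping.keys p"
    by (metis lookup_zero not_in_keys_iff_lookup_eq_zero poly_mapping_eqI)
  with assms(2,3) show ?thesis
    by (auto simp: homogeneous_poly_def)
qed

text \<open>\<open>s\<close> bounds the number of leaves only; \<open>0\<close> is available in every degree, so that homogeneous formulas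
  with subformulas computing \<open>0\<close> are covered.\<close>

inductive hcomp :: "nat set \<Rightarrow> nat \<Rightarrow> nat \<Rightarrow> 'a::field mpoly \<Rightarrow> bool" for V where
  zero: "1 \<le> s \<Longrightarrow> hcomp V s e 0"
| const: "1 \<le> s \<Longrightarrow> hcomp V s 0 (poly_const c)"
| var: "1 \<le> s \<Longrightarrow> i \<in> V \<Longrightarrow> hcomp V s 1 (poly_var i)"
| add: "hcomp V s e p \<Longrightarrow> hcomp V s' e q \<Longrightarrow> hcomp V (s + s') e (p + q)"
| mult: "hcomp V s e p \<Longrightarrow> hcomp V s' e' q \<Longrightarrow> hcomp V (s + s') (e + e') (p * q)"

lemma hcomp_size_pos: "hcomp V s e p \<Longrightarrow> 1 \<le> s"
  by (induction rule: hcomp.induct) auto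

lemma hcomp_form_on: "hcomp V s e p \<Longrightarrow> form_on V e p"
  by (induction rule: hcomp.induct) (auto intro: form_on_var form_on_add form_on_mult simp del: One_nat_def)

lemma hcomp_mono: "hcomp V s e p \<Longrightarrow> s \<le> s' \<Longrightarrow> hcomp V s' e p"
proof -
  assume "hcomp V s e p" "s \<le> s'"
  \<comment> \<open>The surplus \<open>k\<close> is handed to the second child at each gate until a
    leaf absorbs it: the leaf rules admit any \<open>s\<close> from 1 on.\<close>
  moreover have "hcomp V (s + k) e p" if "hcomp V s e p" for k
    using that
  proof (induction arbitrary: k rule: hcomp.induct)
    case (add s e p s' q)
    from hcomp.add[OF add.hyps(1) add.IH(2)[of k]] show ?case by (simp add: add.assoc)
  next
    case (mult s e p s' e' q)
    from hcomp.mult[OF mult.hyps(1) mult.IH(2)[of k]] show ?case by (simp add: add.assoc)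
  qed (auto intro: hcomp.intros simp del: One_nat_def)
  ultimately show ?thesis by (metis le_add_diff_inverse)
qed

lemma hcomp_one: "1 \<le> s \<Longrightarrow> hcomp V s 0 1"
  using hcomp.const[of s V 1] by (simp add: poly_const_1)

text \<open>Unbounded fan-in becomes a chain of binary gates that ends in a leaf for the empty sum.
  The summand 1 is this leaf; \<open>formula_size\<close> pays for it by counting the gate
  itself.\<close>

lemma hcomp_sum_list:
  assumes "\<And>x. x \<in> set xs \<Longrightarrow> hcomp V (g x) e (h x)"
  shows "hcomp V (1 + sum_list (map g xs)) e (sum_list (map h xs))"
  using assms
proof (induction xs)
  case (Cons x xs)
  then have "hcomp V (g x + (1 + sum_list (map g xs))) e (h x + sum_list (map h xs))"
    by (intro hcomp.add) auto
  then show ?case by (simp add: ac_simps)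
qed (auto intro: hcomp.intros)

lemma hcomp_prod_list:
  assumes "\<And>x. x \<in> set xs \<Longrightarrow> hcomp V (g x) (e x) (h x)"
  shows "hcomp V (1 + sum_list (map g xs)) (sum_list (map e xs)) (prod_list (map h xs))"
  using assms
proof (induction xs)
  case (Cons x xs)
  then have "hcomp V (g x + (1 + sum_list (map g xs))) (e x + sum_list (map e xs))
      (h x * prod_list (map h xs))"
    by (intro hcomp.mult) auto
  then show ?case by (simp add: ac_simps)
qed (auto intro: hcomp_one)

section \<open>From homogeneous formulas to homogeneous computations\<close>

lemma sum_list_filter_split:
  fixes h :: "'b \<Rightarrow> 'c::comm_monoid_add"
  shows "sum_list (map h xs) = sum_list (map h (filter P xs)) + sum_list (map h (filter (\<lambda>x. \<not> P x) xs))"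
  by (induction xs) (auto simp: ac_simps)

lemma prod_list_eq_0:
  fixes xs :: "'b::semiring_1 list"
  shows "0 \<in> set xs \<Longrightarrow> prod_list xs = 0"
  by (induction xs) auto

lemma lookup_sum_list:
  "Poly_Mapping.lookup (sum_list xs) k = sum_list (map (\<lambda>x. Poly_Mapping.lookup x k) xs)"
  by (induction xs) (auto simp: lookup_add)

lemma homogeneous_formula_sub:
  "homogeneous_formula (Add fs) \<Longrightarrow> g \<in> set fs \<Longrightarrow> homogeneous_formula g"
  "homogeneous_formula (Mul fs) \<Longrightarrow> g \<in> set fs \<Longrightarrow> homogeneous_formula g"
  by (auto simp: homogeneous_formula_def)

lemma formula_vars_simps [simp]:
  "formula_vars (Var i) = {i}"
  "formula_vars (Const c) = {}"
  "formula_vars (Add fs) = (\<Union>g\<in>set fs. formula_vars g)"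
  "formula_vars (Mul fs) = (\<Union>g\<in>set fs. formula_vars g)"
  by (auto simp: formula_vars_def)

lemma gates_self: "\<phi> \<in> gates \<phi>"
  by (cases \<phi>) auto

lemma homogeneous_formula_poly:
  "homogeneous_formula \<phi> \<Longrightarrow> \<exists>e. homogeneous_poly e (formula_poly \<phi>)"
  using gates_self by (auto simp: homogeneous_formula_def)

text \<open>At an addition gate the children of the wrong degree must cancel, so they can be dropped.\<close>

lemma homogeneous_sum_drop:
  fixes xs :: "'a::comm_ring_1 mpoly list"
  assumes "homogeneous_poly e (sum_list xs)" "\<And>x. x \<in> set xs \<Longrightarrow> \<exists>d. homogeneous_poly d x"
  shows "sum_list xs = sum_list (filter (homogeneous_poly e) xs)"
proof (rule poly_mapping_eqI)
  fix m :: "nat \<Rightarrow>\<^sub>0 nat"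
  let ?l = "\<lambda>x. Poly_Mapping.lookup x m"
  let ?ys = "filter (homogeneous_poly e) xs" and ?zs = "filter (\<lambda>x. \<not> homogeneous_poly e x) xs"
  have split: "?l (sum_list xs) = sum_list (map ?l ?ys) + sum_list (map ?l ?zs)"
    by (simp add: lookup_sum_list sum_list_filter_split[of _ xs "homogeneous_poly e"])
  show "?l (sum_list xs) = ?l (sum_list ?ys)"
  \<comment> \<open>At a monomial of degree \<open>e\<close> the dropped children have coefficient
    0. At any other monomial both sums have coefficient 0, the full one because it is homogeneous of
    degree \<open>e\<close>.\<close>
  proof (cases "mono_degree m = e")
    case True
    then have "?l x = 0" if "x \<in> set ?zs" for x
      using that assms(2)[of x] by (force simp: homogeneous_poly_def in_keys_iff)
    then have "sum_list (map ?l ?zs) = sum_list (map (\<lambda>x. 0) ?zs)"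
      by (intro arg_cong[where f = sum_list] map_cong) auto
    then have "sum_list (map ?l ?zs) = 0"
      by simp
    with split show ?thesis by (simp only: lookup_sum_list[of ?ys] add_0_right)
  next
    case False
    have nz: "?l x = 0" if "homogeneous_poly e x" for x
      using that False by (auto simp: homogeneous_poly_def in_keys_iff)
    have "sum_list (map ?l ?ys) = sum_list (map (\<lambda>x. 0) ?ys)"
      using nz by (intro arg_cong[where f = sum_list] map_cong) auto
    then show ?thesis using nz[OF assms(1)] by (simp add: lookup_sum_list)
  qed
qed

text \<open>The degree \<open>e\<close> is generalised in the induction because a formula computing
  \<open>0\<close> has no degree of its own: it must be usable in whichever degree its parent
  requires.\<close>

lemma hcomp_formula:
  assumes "homogeneous_formula \<phi>" "formula_vars \<phi> \<subseteq> V" "homogeneous_poly e (formula_poly \<phi>)"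
  shows "hcomp V (formula_size \<phi>) e (formula_poly \<phi>)"
  using assms
proof (induction \<phi> arbitrary: e)
  case (Var i)
  have "homogeneous_poly 1 (poly_var i :: 'a mpoly)"
    using form_on_var[of i UNIV] by (simp add: form_on_def)
  moreover have "poly_var i \<noteq> (0 :: 'a mpoly)"
    by (metis poly_var_def keys_single keys_zero insert_not_empty zero_neq_one)
  ultimately have "e = 1"
    using Var.prems(3) homogeneous_poly_unique by auto
  then show ?case using Var.prems by (auto intro: hcomp.var simp del: One_nat_def)
next
  case (Const c)
  show ?case
  proof (cases "c = 0")
    case True
    then show ?thesis by (auto simp: poly_const_def intro: hcomp.zero)
  next
    case False
    then have "poly_const c \<noteq> 0"
      by (metis poly_const_def keys_single keys_zero insert_not_empty)
    moreover have "homogeneous_poly 0 (poly_const c)"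
      using form_on_const[of UNIV c] by (simp add: form_on_def del: form_on_const)
    ultimately have "e = 0"
      using Const.prems(3) homogeneous_poly_unique by auto
    then show ?thesis by (auto intro: hcomp.const)
  qed
next
  case (Add fs)
  let ?gs = "filter (\<lambda>g. homogeneous_poly e (formula_poly g)) fs"
  have "\<forall>g\<in>set fs. \<exists>d. homogeneous_poly d (formula_poly g)"
    using homogeneous_formula_sub(1)[OF Add.prems(1)] homogeneous_formula_poly by blast
  then have "sum_list (map formula_poly fs) = sum_list (filter (homogeneous_poly e) (map formula_poly fs))"
    using Add.prems(3) by (intro homogeneous_sum_drop) auto
  then have eq: "formula_poly (Add fs) = sum_list (map formula_poly ?gs)"
    by (simp add: filter_map comp_def)
  have "hcomp V (1 + sum_list (map formula_size ?gs)) e (sum_list (map formula_poly ?gs))"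
    using Add.IH Add.prems(2) homogeneous_formula_sub(1)[OF Add.prems(1)]
    by (intro hcomp_sum_list) auto
  moreover have "sum_list (map formula_size ?gs) \<le> sum_list (map formula_size fs)"
    by (subst (2) sum_list_filter_split[of _ _ "\<lambda>g. homogeneous_poly e (formula_poly g)"]) simp
  ultimately show ?case
    unfolding eq by (auto elim: hcomp_mono)
next
  case (Mul fs)
  have "\<forall>g\<in>set fs. \<exists>k. homogeneous_poly k (formula_poly g)"
    using Mul.prems homogeneous_formula_sub(2) homogeneous_formula_poly by blast
  then obtain k where k: "\<And>g. g \<in> set fs \<Longrightarrow> homogeneous_poly (k g) (formula_poly g)"
    by metis
  have "hcomp V (1 + sum_list (map formula_size fs)) (sum_list (map k fs)) (prod_list (map formula_poly fs))"
  proof (rule hcomp_prod_list)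
    fix g assume g: "g \<in> set fs"
    with Mul.prems(2) have "formula_vars g \<subseteq> V" by auto
    then show "hcomp V (formula_size g) (k g) (formula_poly g)"
      using Mul.IH g k homogeneous_formula_sub(2)[OF Mul.prems(1)] by blast
  qed
  then have h: "hcomp V (formula_size (Mul fs)) (sum_list (map k fs)) (formula_poly (Mul fs))"
    by simp
  \<comment> \<open>If the product is nonzero, the degrees of its factors add up to
    \<open>e\<close>. If it is \<open>0\<close>, they need not, and a single leaf \<open>0\<close>
    of degree \<open>e\<close> replaces the gate.\<close>
  show ?case
  proof (cases "formula_poly (Mul fs) = 0")
    case True
    show ?thesis unfolding True by (auto intro: hcomp.zero)
  next
    case False
    moreover have "homogeneous_poly (sum_list (map k fs)) (formula_poly (Mul fs))"
      using hcomp_form_on[OF h] by (simp add: form_on_def)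
    ultimately show ?thesis
      using Mul.prems(3) h homogeneous_poly_unique by metis
  qed
qed

subsection \<open>Logarithmic product decomposition\<close>

text \<open>The degree \<open>r\<close> still to be split drops by a factor between 3/2 and 3 in each step, hence a chain has
  logarithmically many factors.\<close>

inductive log_chain :: "nat set \<Rightarrow> nat \<Rightarrow> nat \<Rightarrow> 'a::field mpoly list \<Rightarrow> bool" for V S where
  single: "hcomp V S 1 p \<Longrightarrow> log_chain V S 1 [p]"
| cons: "hcomp V S e h \<Longrightarrow> log_chain V S r qs \<Longrightarrow> 1 \<le> e \<Longrightarrow> r \<le> 2 * e \<Longrightarrow> e \<le> 2 * r \<Longrightarrow>
    log_chain V S (e + r) (h # qs)"

lemma log_chain_pos: "log_chain V S r qs \<Longrightarrow> 1 \<le> r"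
  by (induction rule: log_chain.induct) auto

lemma sum_list_mult_right:
  fixes f :: "'b \<Rightarrow> 'c::semiring_0"
  shows "sum_list (map f xs) * c = sum_list (map (\<lambda>x. f x * c) xs)"
  by (induction xs) (auto simp: distrib_right)

text \<open>The state during the descent: \<open>qs\<close> is the chain for the gate that was
  reached, of degree \<open>r\<close>, and \<open>h\<close> collects the factors passed on the way.
  The same \<open>s\<close> bounds the number of terms and the size of each \<open>h\<close>; both
  bounds behave additively at gates.\<close>

definition log_split :: "nat set \<Rightarrow> nat \<Rightarrow> nat \<Rightarrow> nat \<Rightarrow> nat \<Rightarrow> nat \<Rightarrow> 'a::field mpoly \<Rightarrow> bool" where
  "log_split V S a b s e p \<longleftrightarrow>
    (\<exists>ts. length ts \<le> s \<and> p = sum_list (map (\<lambda>(h, qs). h * prod_list qs) ts) \<and>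
      (\<forall>(h, qs)\<in>set ts. \<exists>r. a \<le> r \<and> r \<le> b \<and> r \<le> e \<and> hcomp V s (e - r) h \<and> log_chain V S r qs))"

lemma log_split_add:
  assumes "log_split V S a b s e p" "log_split V S a b s' e q"
  shows "log_split V S a b (s + s') e (p + q)"
proof -
  let ?P = "\<lambda>s h qs. \<exists>r. a \<le> r \<and> r \<le> b \<and> r \<le> e \<and> hcomp V s (e - r) h \<and> log_chain V S r qs"
  obtain ts ts' where ts: "length ts \<le> s" "p = sum_list (map (\<lambda>(h, qs). h * prod_list qs) ts)"
    "\<And>h qs. (h, qs) \<in> set ts \<Longrightarrow> ?P s h qs"
    and ts': "length ts' \<le> s'" "q = sum_list (map (\<lambda>(h, qs). h * prod_list qs) ts')"
    "\<And>h qs. (h, qs) \<in> set ts' \<Longrightarrow> ?P s' h qs"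
    using assms unfolding log_split_def by blast
  have mono: "?P s h qs \<Longrightarrow> ?P (s + s') h qs" "?P s' h qs \<Longrightarrow> ?P (s + s') h qs" for h qs
    by (meson hcomp_mono le_add1 le_add2)+
  have "?P (s + s') h qs" if "(h, qs) \<in> set (ts @ ts')" for h qs
    using that ts(3) ts'(3) mono by (metis Un_iff set_append)
  moreover have "length (ts @ ts') \<le> s + s'"
    "p + q = sum_list (map (\<lambda>(h, qs). h * prod_list qs) (ts @ ts'))"
    using ts ts' by auto
  ultimately show ?thesis
    unfolding log_split_def by (intro exI[of _ "ts @ ts'"]) blast
qed

text \<open>The factor that the descent does not enter is absorbed into each \<open>h\<close>, so it
  adds to the size of \<open>h\<close> without creating new terms.\<close>

lemma log_split_mult:
  assumes "log_split V S a b s e p" "hcomp V s' e' q"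
  shows "log_split V S a b (s + s') (e + e') (p * q)"
proof -
  obtain ts where ts: "length ts \<le> s" "p = sum_list (map (\<lambda>(h, qs). h * prod_list qs) ts)"
    "\<And>h qs. (h, qs) \<in> set ts \<Longrightarrow>
      \<exists>r. a \<le> r \<and> r \<le> b \<and> r \<le> e \<and> hcomp V s (e - r) h \<and> log_chain V S r qs"
    using assms(1) unfolding log_split_def by blast
  let ?us = "map (\<lambda>(h, qs). (h * q, qs)) ts"
  have "p * q = sum_list (map (\<lambda>(h, qs). h * prod_list qs) ?us)"
    unfolding ts(2) sum_list_mult_right by (simp add: comp_def case_prod_unfold ac_simps)
  moreover have "\<exists>r. a \<le> r \<and> r \<le> b \<and> r \<le> e + e' \<and> hcomp V (s + s') (e + e' - r) h \<and>
      log_chain V S r qs" if "(h, qs) \<in> set ?us" for h qs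
  proof -
    from that obtain h' where h': "(h', qs) \<in> set ts" "h = h' * q" by auto
    from ts(3)[OF h'(1)] obtain r where r: "a \<le> r" "r \<le> b" "r \<le> e" "hcomp V s (e - r) h'"
      "log_chain V S r qs" by blast
    from hcomp.mult[OF r(4) assms(2)] r(3) have "hcomp V (s + s') (e + e' - r) h"
      by (simp add: h'(2))
    with r show ?thesis by (intro exI[of _ r]) simp
  qed
  moreover have "length ?us \<le> s + s'" using ts(1) by simp
  ultimately show ?thesis
    unfolding log_split_def by (intro exI[of _ ?us]) blast
qed

text \<open>Descend from the output, at each product gate into a factor of degree at least \<open>m\<close>, until all
  factors have degree below \<open>m\<close>. The degree is then between \<open>m\<close> and \<open>2d/3\<close>, the subpolynomial reached
  is split recursively, and the other factors passed on the way make up \<open>h\<close>. Every term is charged to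
  a leaf below the gate that was reached, so that there are at most \<open>s\<close> terms in total.\<close>

lemma log_split_hcomp:
  fixes p :: "'a::field mpoly"
  assumes IH: "\<And>e s (q :: 'a mpoly). e < d \<Longrightarrow> 1 \<le> e \<Longrightarrow> hcomp V s e q \<Longrightarrow> s \<le> S \<Longrightarrow>
      \<exists>ts. length ts \<le> s \<and> q = sum_list (map prod_list ts) \<and> (\<forall>qs\<in>set ts. log_chain V S e qs)"
    and d: "2 \<le> d" "d \<le> 3 * m" "3 * m \<le> d + 2"
  shows "hcomp V s e p \<Longrightarrow> m \<le> e \<Longrightarrow> s \<le> S \<Longrightarrow> log_split V S m (2 * d div 3) s e p"
proof (induction rule: hcomp.induct)
  case (zero s e)
  then show ?case unfolding log_split_def by (intro exI[of _ "[]"]) auto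
next
  case (const s c)
  then show ?case using d by auto
next
  case (var s i)
  then have "hcomp V S 1 (poly_var i :: 'a mpoly)" "hcomp V s 0 (1 :: 'a mpoly)" "m = 1"
    using d by (auto intro: hcomp.var hcomp_one simp del: One_nat_def)
  moreover have "1 \<le> 2 * d div 3" using d by presburger
  ultimately show ?case
    using var unfolding log_split_def by (intro exI[of _ "[(1, [poly_var i])]"])
      (auto intro!: exI[of _ 1] log_chain.single simp del: One_nat_def)
next
  case (add s e p s' q)
  then show ?case by (intro log_split_add) auto
next
  case (mult s e p s' e' q)
  consider "m \<le> e" | "m \<le> e'" | "e < m" "e' < m" by linarith
  then show ?case
  proof cases
    case 1
    with mult show ?thesis by (intro log_split_mult) auto
  next
    case 2
    with mult have "log_split V S m (2 * d div 3) (s' + s) (e' + e) (q * p)"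
      by (intro log_split_mult) auto
    then show ?thesis by (simp add: ac_simps)
  next
    \<comment> \<open>This is the gate where the descent stops. Both degrees are at most
      \<open>m - 1\<close>, so \<open>3 * (e + e')\<close> is at most \<open>6 * m - 6\<close>,
      hence at most \<open>2 * d - 2\<close>. The hypothesis for smaller degrees applies, and
      nothing has been passed yet: \<open>h\<close> is 1.\<close>
    case 3
    have hc: "hcomp V (s + s') (e + e') (p * q)"
      using mult.hyps by (rule hcomp.mult)
    have e: "e + e' < d" "1 \<le> e + e'" "e + e' \<le> 2 * d div 3"
      using 3 d mult.prems by auto
    obtain ts where ts: "length ts \<le> s + s'" "p * q = sum_list (map prod_list ts)"
      "\<And>qs. qs \<in> set ts \<Longrightarrow> log_chain V S (e + e') qs"
      using IH[OF e(1,2) hc mult.prems(2)] by blast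
    have "hcomp V (s + s') 0 (1 :: 'a mpoly)"
      using hcomp_size_pos[OF hc] by (rule hcomp_one)
    with ts e mult.prems show ?thesis
      unfolding log_split_def by (intro exI[of _ "map (Pair 1) ts"]) (auto simp: comp_def)
  qed
qed

text \<open>Two size bounds are kept apart. The number of terms is bounded by the size
  \<open>s\<close> of the polynomial at hand, which the recursive calls need; the factors only need
  the global bound \<open>S\<close>, which stays fixed in the recursion.\<close>

lemma log_chain_decomposition:
  fixes p :: "'a::field mpoly"
  assumes "hcomp V s d p" "1 \<le> d" "s \<le> S"
  shows "\<exists>ts. length ts \<le> s \<and> p = sum_list (map prod_list ts) \<and> (\<forall>qs\<in>set ts. log_chain V S d qs)"
  using assms
proof (induction d arbitrary: s p rule: less_induct)
  case (less d)
  show ?case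
  proof (cases "d = 1")
    case True
    with less.prems have "hcomp V S 1 p" "1 \<le> s"
      by (auto elim: hcomp_mono dest: hcomp_size_pos)
    with True show ?thesis
      by (intro exI[of _ "[[p]]"]) (auto intro: log_chain.single simp del: One_nat_def)
  next
    case False
    \<comment> \<open>This is \<open>d/3\<close> rounded up. From \<open>r\<close> at least
      \<open>m\<close> follows that \<open>d - r\<close> is at most \<open>2 * r\<close>, and from
      \<open>r\<close> at most \<open>2 * d / 3\<close> that \<open>r\<close> is at most
      \<open>2 * (d - r)\<close>: the two balance conditions of a chain.\<close>
    define m where "m = (d + 2) div 3"
    have m: "2 \<le> d" "d \<le> 3 * m" "3 * m \<le> d + 2" "m \<le> d"
      using False less.prems by (auto simp: m_def)
    have "log_split V S m (2 * d div 3) s d p"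
      using less.IH m(1-3) less.prems(1) m(4) less.prems(3) by (rule log_split_hcomp)
    then obtain ts where ts: "length ts \<le> s"
      "p = sum_list (map (\<lambda>(h, qs). h * prod_list qs) ts)"
      "\<And>h qs. (h, qs) \<in> set ts \<Longrightarrow> \<exists>r. m \<le> r \<and> r \<le> 2 * d div 3 \<and> r \<le> d \<and>
        hcomp V s (d - r) h \<and> log_chain V S r qs"
      unfolding log_split_def by blast
    have chain: "log_chain V S d (h # qs)" if hqs: "(h, qs) \<in> set ts" for h qs
    proof -
      from ts(3)[OF hqs] obtain r where r: "m \<le> r" "r \<le> 2 * d div 3" "r \<le> d"
        "hcomp V s (d - r) h" "log_chain V S r qs" by blast
      have "log_chain V S (d - r + r) (h # qs)"
        using r m less.prems(3) by (intro log_chain.cons) (auto elim: hcomp_mono)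
      with r(3) show ?thesis by simp
    qed
    show ?thesis
    proof (intro exI conjI ballI)
      show "length (map (\<lambda>(h, qs). h # qs) ts) \<le> s" using ts(1) by simp
      show "p = sum_list (map prod_list (map (\<lambda>(h, qs). h # qs) ts))"
        unfolding ts(2) by (simp add: comp_def case_prod_unfold)
      show "log_chain V S d us" if "us \<in> set (map (\<lambda>(h, qs). h # qs) ts)" for us
        using that chain by auto
    qed
  qed
qed

subsection \<open>Expansion into factors of degree less than t\<close>

text \<open>The bounds \<open>N\<close> and \<open>k\<close> are real, so that powers and logarithms
  can be inserted without rounding. The factors are kept only as forms and no longer as
  computations: their monomials will be written out in the two bottom layers, which does not affect
  the top fan-in.\<close>

definition expands :: "nat set \<Rightarrow> nat \<Rightarrow> real \<Rightarrow> real \<Rightarrow> 'a::field mpoly \<Rightarrow> bool" where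
  "expands V t N k p \<longleftrightarrow>
    (\<exists>ts. real (length ts) \<le> N \<and> p = sum_list (map prod_list ts) \<and>
      (\<forall>qs\<in>set ts. k \<le> real (length qs) \<and> (\<forall>q\<in>set qs. \<exists>e. 0 < e \<and> e < t \<and> form_on V e q)))"

lemma expands_mono: "expands V t N k p \<Longrightarrow> N \<le> N' \<Longrightarrow> k' \<le> k \<Longrightarrow> expands V t N' k' p"
  unfolding expands_def by (elim exE, rule exI) (force intro: order_trans)

lemma expands_0: "expands V t 0 k 0"
  unfolding expands_def by (intro exI[of _ "[]"]) auto

lemma expands_single: "form_on V e p \<Longrightarrow> 0 < e \<Longrightarrow> e < t \<Longrightarrow> expands V t 1 1 p"
  unfolding expands_def by (intro exI[of _ "[[p]]"]) auto

lemma expands_add: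
  assumes "expands V t N k p" "expands V t M k q"
  shows "expands V t (N + M) k (p + q)"
proof -
  obtain ts us where "real (length ts) \<le> N" "p = sum_list (map prod_list ts)"
      "\<forall>qs\<in>set ts. k \<le> real (length qs) \<and> (\<forall>q\<in>set qs. \<exists>e. 0 < e \<and> e < t \<and> form_on V e q)"
      "real (length us) \<le> M" "q = sum_list (map prod_list us)"
      "\<forall>qs\<in>set us. k \<le> real (length qs) \<and> (\<forall>q\<in>set qs. \<exists>e. 0 < e \<and> e < t \<and> form_on V e q)"
    using assms unfolding expands_def by blast
  then show ?thesis
    unfolding expands_def by (intro exI[of _ "ts @ us"]) auto
qed

lemma expands_sum_list:
  assumes "\<And>x. x \<in> set xs \<Longrightarrow> expands V t N k x"
  shows "expands V t (real (length xs) * N) k (sum_list xs)"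
  using assms
proof (induction xs)
  case (Cons x xs)
  then have "expands V t (N + real (length xs) * N) k (x + sum_list xs)"
    by (intro expands_add) auto
  then show ?case by (simp add: algebra_simps)
qed (simp add: expands_0)

lemma sum_list_prod_product:
  fixes ts us :: "'b::comm_semiring_1 list list"
  shows "sum_list (map prod_list ts) * sum_list (map prod_list us) =
    sum_list (map (\<lambda>(a, b). prod_list (a @ b)) (List.product ts us))"
  by (induction ts) (simp_all add: algebra_simps comp_def sum_list_const_mult)

lemma expands_mult:
  assumes "expands V t N k p" "expands V t M l q"
  shows "expands V t (N * M) (k + l) (p * q)"
proof -
  let ?P = "\<lambda>qs. \<forall>q\<in>set qs. \<exists>e. 0 < e \<and> e < t \<and> form_on V e q"
  obtain ts us where ts: "real (length ts) \<le> N" "p = sum_list (map prod_list ts)"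
      "\<And>qs. qs \<in> set ts \<Longrightarrow> k \<le> real (length qs) \<and> ?P qs"
    and us: "real (length us) \<le> M" "q = sum_list (map prod_list us)"
      "\<And>qs. qs \<in> set us \<Longrightarrow> l \<le> real (length qs) \<and> ?P qs"
    using assms unfolding expands_def by blast
  let ?vs = "map (\<lambda>(a, b). a @ b) (List.product ts us)"
  have "real (length ts) * real (length us) \<le> N * M"
    using ts(1) us(1) by (intro mult_mono) (auto intro: order_trans[OF of_nat_0_le_iff])
  then have "real (length ?vs) \<le> N * M" by simp
  moreover have "p * q = sum_list (map prod_list ?vs)"
    unfolding ts(2) us(2) sum_list_prod_product by (simp add: comp_def case_prod_unfold)
  moreover have "k + l \<le> real (length vs) \<and> ?P vs" if "vs \<in> set ?vs" for vs
  proof -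
    from that obtain a b where "vs = a @ b" "a \<in> set ts" "b \<in> set us" by auto
    with ts(3)[of a] us(3)[of b] show ?thesis by auto
  qed
  ultimately show ?thesis unfolding expands_def by (intro exI[of _ ?vs]) auto
qed

text \<open>At \<open>d = 3 * t\<close> this is 1 + (log t)/2, the number of factors guaranteed by a
  chain of degree at least \<open>t\<close>; smaller degrees ask for less.\<close>

definition factor_bound :: "nat \<Rightarrow> nat \<Rightarrow> real" where
  "factor_bound t d = real d / (3 * real t) * (1 + log 2 (real t) / 2)"

lemma factor_bound_add: "factor_bound t (d + d') = factor_bound t d + factor_bound t d'"
  by (simp add: factor_bound_def add_divide_distrib distrib_right)

definition term_exp :: "nat \<Rightarrow> nat \<Rightarrow> real" where
  "term_exp t d = (if d < t then 0 else 2 * real d / real t - 1)"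

text \<open>While the degree left is at least \<open>3t\<close>, both parts of its splitting have degree at least \<open>t\<close> and
  \<open>factor_bound\<close> is additive; once it is below \<open>3t\<close>, the number of factors of the chain suffices. The \<open>-1\<close> in \<open>term_exp\<close> and the \<open>-2\<close>
  below pay for the factor \<open>S\<close> that each expansion of a large factor costs.\<close>

lemma log_chain_expands:
  fixes qs :: "'a::field mpoly list"
  assumes "log_chain V S r qs" "2 \<le> t" "1 \<le> S" "r \<le> d" "1 < d"
    and "\<And>e (q :: 'a mpoly). 0 < e \<Longrightarrow> e < d \<Longrightarrow> hcomp V S e q \<Longrightarrow>
      \<exists>k\<ge>1. (t \<le> e \<longrightarrow> factor_bound t e \<le> k) \<and> expands V t (real S powr term_exp t e) k q"
  shows "\<exists>k. 1 + log 2 (real r) / 2 \<le> k \<and> (t \<le> r \<longrightarrow> factor_bound t r \<le> k) \<and>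
    expands V t (real S powr max 0 (2 * real r / real t - 2)) k (prod_list qs)"
  using assms(1,4)
proof (induction rule: log_chain.induct)
  case (single p)
  with assms obtain k where k: "k \<ge> 1" "expands V t (real S powr term_exp t 1) k p"
    by (metis zero_less_one)
  moreover have "2 * real 1 / real t - 2 \<le> 0" using assms(2) by (simp add: field_simps)
  ultimately show ?case
    using assms(2,3) by (intro exI[of _ k]) (auto simp: term_exp_def max_def)
next
  case (cons e h r qs)
  have r1: "1 \<le> r" using cons.hyps(2) by (rule log_chain_pos)
  obtain k where k: "1 \<le> k" "t \<le> e \<longrightarrow> factor_bound t e \<le> k"
    "expands V t (real S powr term_exp t e) k h"
    using assms(6)[of e h] cons.hyps cons.prems r1 by auto
  obtain l where l: "1 + log 2 (real r) / 2 \<le> l" "t \<le> r \<longrightarrow> factor_bound t r \<le> l"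
    "expands V t (real S powr max 0 (2 * real r / real t - 2)) l (prod_list qs)"
    using cons.IH cons.prems by auto
  \<comment> \<open>Balance gives \<open>e + r\<close> at most \<open>3 * r\<close>. Rounding 3 up
    to 4 raises half the logarithm by exactly 1, which the at least one factor coming from
    \<open>h\<close> pays for.\<close>
  have "log 2 (real (e + r)) \<le> log 2 (4 * real r)"
    using cons.hyps r1 by simp
  also have "\<dots> = log 2 (2 powr 2) + log 2 (real r)"
    using r1 by (subst log_mult) auto
  also have "\<dots> = 2 + log 2 (real r)"
    by (subst log_powr_cancel) auto
  finally have kl: "1 + log 2 (real (e + r)) / 2 \<le> k + l"
    using k(1) l(1) by simp
  have fb: "factor_bound t (e + r) \<le> k + l" if "t \<le> e + r"
  proof (cases "3 * t \<le> e + r")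
    case True
    with cons.hyps have "t \<le> e" "t \<le> r" by auto
    with k l show ?thesis by (simp add: factor_bound_add)
  next
    case False
    have "log 2 (real t) \<le> log 2 (real (e + r))"
      using that assms(2) by simp
    moreover have "0 \<le> log 2 (real t)" using assms(2) by simp
    moreover have "factor_bound t (e + r) \<le> 1 * (1 + log 2 (real t) / 2)"
      unfolding factor_bound_def using False assms(2) \<open>0 \<le> log 2 (real t)\<close>
      by (intro mult_right_mono) (auto simp: field_simps)
    ultimately have "factor_bound t (e + r) \<le> 1 + log 2 (real (e + r)) / 2" by simp
    also note kl
    finally show ?thesis .
  qed
  \<comment> \<open>If \<open>e\<close> is below \<open>t\<close>, then \<open>h\<close> costs
    nothing. Otherwise \<open>2 * r\<close> is at least \<open>e\<close>, hence at least
    \<open>t\<close>, so the maximum on the left is at most \<open>2 * r / t - 1\<close>; adding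
    \<open>2 * e / t - 1\<close> gives the bound.\<close>
  have "term_exp t e + max 0 (2 * real r / real t - 2) \<le> max 0 (2 * real (e + r) / real t - 2)"
  proof (cases "e < t")
    case True
    then show ?thesis using assms(2) by (auto simp: term_exp_def max_def field_simps)
  next
    case False
    then have "1 \<le> 2 * real r / real t" using assms(2) cons.hyps by (simp add: field_simps)
    with False show ?thesis by (auto simp: term_exp_def add_divide_distrib distrib_left)
  qed
  then have "real S powr term_exp t e * real S powr max 0 (2 * real r / real t - 2)
      \<le> real S powr max 0 (2 * real (e + r) / real t - 2)"
    using assms(3) by (auto simp flip: powr_add intro!: powr_mono)
  with expands_mult[OF k(3) l(3)]
  have "expands V t (real S powr max 0 (2 * real (e + r) / real t - 2)) (k + l) (prod_list (h # qs))"
    by (auto elim: expands_mono)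
  with kl fb show ?case by blast
qed

text \<open>Strong induction on the degree with \<open>S\<close> fixed: the factors of a chain again
  have computations of size \<open>S\<close>, so repeated expansion does not worsen the size
  bound.\<close>

lemma hcomp_expands:
  fixes p :: "'a::field mpoly"
  assumes "hcomp V S d p" "2 \<le> t" "0 < d"
  shows "\<exists>k\<ge>1. (t \<le> d \<longrightarrow> factor_bound t d \<le> k) \<and> expands V t (real S powr term_exp t d) k p"
  using assms(1,3)
proof (induction d arbitrary: p rule: less_induct)
  case (less d)
  have S: "1 \<le> S" using less.prems hcomp_size_pos by blast
  show ?case
  proof (cases "d < t")
    case True
    with less.prems S have "expands V t (real S powr term_exp t d) 1 p"
      by (auto intro: expands_single dest: hcomp_form_on simp: term_exp_def)
    with True show ?thesis by (intro exI[of _ 1]) auto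
  next
    case False
    \<comment> \<open>Different chains yield different numbers of factors; this is a lower bound
      common to all terms.\<close>
    let ?k = "max 1 (factor_bound t d)"
    let ?N = "real S powr max 0 (2 * real d / real t - 2)"
    obtain ts where ts: "length ts \<le> S" "p = sum_list (map prod_list ts)"
      "\<And>qs. qs \<in> set ts \<Longrightarrow> log_chain V S d qs"
      using log_chain_decomposition[OF less.prems(1)] less.prems(2) by fastforce
    have "expands V t ?N ?k x" if x: "x \<in> set (map prod_list ts)" for x
    proof -
      from x obtain qs where qs: "x = prod_list qs" "log_chain V S d qs"
        using ts(3) by auto
      have "\<exists>k. 1 + log 2 (real d) / 2 \<le> k \<and> (t \<le> d \<longrightarrow> factor_bound t d \<le> k) \<and> expands V t ?N k (prod_list qs)"
        using qs(2) assms(2) S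
      proof (rule log_chain_expands[where d = d])
        show "1 < d" using False assms(2) by simp
      qed (use less.IH in auto)
      then obtain k where k: "1 + log 2 (real d) / 2 \<le> k" "t \<le> d \<longrightarrow> factor_bound t d \<le> k"
        "expands V t ?N k (prod_list qs)" by blast
      moreover have "0 \<le> log 2 (real d)" using less.prems(2) by simp
      ultimately have "?k \<le> k" using False by simp
      with k(3) qs(1) show ?thesis by (auto elim: expands_mono)
    qed
    from expands_sum_list[of "map prod_list ts", OF this]
    have "expands V t (real (length ts) * ?N) ?k p" by (simp add: ts(2))
    moreover have "real (length ts) * ?N \<le> real S powr 1 * ?N"
      using ts(1) by (intro mult_right_mono) auto
    \<comment> \<open>The sum over at most \<open>S\<close> chains costs 1 in the exponent, and here
      the maximum is \<open>2 * d / t - 2\<close>.\<close>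
    moreover have "1 + max 0 (2 * real d / real t - 2) = term_exp t d"
      using False assms(2) by (simp add: term_exp_def max_def field_simps)
    ultimately have "expands V t (real S powr term_exp t d) ?k p"
      by (metis (no_types, lifting) expands_mono order_refl powr_add)
    then show ?thesis by (intro exI[of _ ?k]) auto
  qed
qed

subsection \<open>Depth-four formulas\<close>

definition mono_vars :: "(nat \<Rightarrow>\<^sub>0 nat) \<Rightarrow> nat list" where
  "mono_vars m = concat (map (\<lambda>i. replicate (Poly_Mapping.lookup m i) i)
     (sorted_list_of_set (Poly_Mapping.keys m)))"

lemma set_mono_vars: "set (mono_vars m) \<subseteq> Poly_Mapping.keys m"
  by (auto simp: mono_vars_def)

lemma length_mono_vars: "length (mono_vars m) = mono_degree m"
  by (simp add: mono_vars_def mono_degree_def length_concat comp_def sum_list_distinct_conv_sum_set)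

lemma prod_list_poly_var:
  "prod_list (map poly_var is) = (Poly_Mapping.single (sum_list (map (\<lambda>i. Poly_Mapping.single i 1) is)) 1 :: 'a::field mpoly)"
  by (induction "is") (auto simp: poly_var_def mult_single)

lemma sum_list_mono_vars: "sum_list (map (\<lambda>i. Poly_Mapping.single i 1) (mono_vars m)) = m"
proof (rule poly_mapping_eqI)
  fix j :: nat
  have rep: "sum_list (map (\<lambda>i. (1::nat) when i = j) (replicate n i)) = (n when i = j)" for i n
    by (induction n) (auto simp: when_def)
  have concat: "sum_list (map g (concat (map h xs))) = sum_list (map (\<lambda>x. sum_list (map g (h x))) xs)"
    for g :: "nat \<Rightarrow> nat" and h and xs :: "nat list"
    by (induction xs) auto
  have "Poly_Mapping.lookup (sum_list (map (\<lambda>i. Poly_Mapping.single i 1) (mono_vars m))) j =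
      sum_list (map (\<lambda>i. 1 when i = j) (mono_vars m))"
    by (simp add: lookup_sum_list comp_def lookup_single)
  also have "\<dots> = (\<Sum>i\<in>Poly_Mapping.keys m. Poly_Mapping.lookup m i when i = j)"
    by (simp add: mono_vars_def concat rep sum_list_distinct_conv_sum_set
        del: map_replicate One_nat_def)
  also have "\<dots> = Poly_Mapping.lookup m j"
    by (auto simp: when_def in_keys_iff)
  finally show "Poly_Mapping.lookup (sum_list (map (\<lambda>i. Poly_Mapping.single i 1) (mono_vars m))) j =
    Poly_Mapping.lookup m j" .
qed

lemma prod_list_mono_vars: "prod_list (map poly_var (mono_vars m)) = (Poly_Mapping.single m 1 :: 'a::field mpoly)"
  by (simp only: prod_list_poly_var sum_list_mono_vars)

lemma sum_single_keys:
  "(\<Sum>m\<in>Poly_Mapping.keys p. Poly_Mapping.single m (Poly_Mapping.lookup p m)) = p"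
proof (rule poly_mapping_eqI)
  fix m
  show "Poly_Mapping.lookup (\<Sum>m\<in>Poly_Mapping.keys p. Poly_Mapping.single m (Poly_Mapping.lookup p m)) m =
    Poly_Mapping.lookup p m"
    by (auto simp: lookup_sum lookup_single when_def in_keys_iff)
qed

text \<open>An arbitrary enumeration: only its set and its distinctness matter, so no order on
  monomials is fixed.\<close>

definition keys_list :: "('b \<Rightarrow>\<^sub>0 'c::zero) \<Rightarrow> 'b list" where
  "keys_list p = (SOME xs. set xs = Poly_Mapping.keys p \<and> distinct xs)"

lemma keys_list: "set (keys_list p) = Poly_Mapping.keys p" "distinct (keys_list p)"
proof -
  have "\<exists>xs. set xs = Poly_Mapping.keys p \<and> distinct xs"
    by (simp add: finite_distinct_list)
  then have "set (keys_list p) = Poly_Mapping.keys p \<and> distinct (keys_list p)"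
    unfolding keys_list_def by (rule someI_ex)
  then show "set (keys_list p) = Poly_Mapping.keys p" "distinct (keys_list p)" by auto
qed

lemma sum_list_keys_list: "sum_list (map g (keys_list p)) = (\<Sum>m\<in>Poly_Mapping.keys p. g m)"
  by (simp add: sum_list_distinct_conv_sum_set keys_list)

definition monomial_formula :: "'a::field mpoly \<Rightarrow> (nat \<Rightarrow>\<^sub>0 nat) \<Rightarrow> 'a formula" where
  "monomial_formula p m = Mul (Const (Poly_Mapping.lookup p m) # map Var (mono_vars m))"

definition sparse_formula :: "'a::field mpoly \<Rightarrow> 'a formula" where
  "sparse_formula p = Add (map (monomial_formula p) (keys_list p))"

lemma formula_poly_monomial:
  "formula_poly (monomial_formula p m) = Poly_Mapping.single m (Poly_Mapping.lookup p m)"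
  by (simp add: monomial_formula_def comp_def prod_list_mono_vars poly_const_def mult_single)

lemma formula_poly_sparse [simp]: "formula_poly (sparse_formula p) = p"
  by (simp add: sparse_formula_def comp_def formula_poly_monomial sum_list_keys_list sum_single_keys)

lemma homogeneous_formula_simps [simp]:
  "homogeneous_formula (Var i :: 'a::field formula)"
  "homogeneous_formula (Const c :: 'a formula)"
  "homogeneous_formula (Add fs :: 'a formula) \<longleftrightarrow>
    (\<exists>e. homogeneous_poly e (sum_list (map formula_poly fs))) \<and> (\<forall>g\<in>set fs. homogeneous_formula g)"
  "homogeneous_formula (Mul fs :: 'a formula) \<longleftrightarrow>
    (\<exists>e. homogeneous_poly e (prod_list (map formula_poly fs))) \<and> (\<forall>g\<in>set fs. homogeneous_formula g)"
proof -
  show "homogeneous_formula (Var i :: 'a formula)"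
    using form_on_var[of i UNIV] by (auto simp: homogeneous_formula_def form_on_def simp del: One_nat_def)
  show "homogeneous_formula (Const c :: 'a formula)"
    using form_on_const[of UNIV c] by (auto simp: homogeneous_formula_def form_on_def simp del: form_on_const)
qed (auto simp: homogeneous_formula_def)

lemma homogeneous_prod_list:
  fixes xs :: "'a::comm_semiring_1 mpoly list"
  assumes "\<And>x. x \<in> set xs \<Longrightarrow> \<exists>e. homogeneous_poly e x"
  shows "\<exists>e. homogeneous_poly e (prod_list xs)"
  using assms
proof (induction xs)
  case Nil
  have "homogeneous_poly 0 (1 :: 'a mpoly)" by (simp add: homogeneous_poly_def)
  then show ?case by auto
next
  case (Cons x xs)
  then obtain d e where "homogeneous_poly d x" "homogeneous_poly e (prod_list xs)"
    by fastforce
  then have "form_on UNIV (d + e) (x * prod_list xs)"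
    by (intro form_on_mult) (auto simp: form_on_def)
  then show ?case by (auto simp: form_on_def)
qed

lemma homogeneous_monomial_formula: "homogeneous_formula (monomial_formula p m)"
proof -
  have "homogeneous_poly (mono_degree m) (formula_poly (monomial_formula p m))"
    unfolding formula_poly_monomial by (auto simp: homogeneous_poly_def)
  then show ?thesis by (auto simp: monomial_formula_def)
qed

lemma homogeneous_sparse_formula:
  assumes "homogeneous_poly e p"
  shows "homogeneous_formula (sparse_formula p)"
proof -
  have "homogeneous_poly e (formula_poly (sparse_formula p))" using assms by simp
  then show ?thesis
    unfolding sparse_formula_def by (auto simp: homogeneous_monomial_formula)
qed

lemma formula_vars_sparse: "formula_vars (sparse_formula p) \<subseteq> poly_vars p"
  using set_mono_vars
  by (auto simp: sparse_formula_def monomial_formula_def poly_vars_def keys_list formula_vars_def subset_iff)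

lemma constant_poly_homogeneous:
  assumes "constant_poly p" "homogeneous_poly e p" "0 < e"
  shows "p = 0"
proof (rule ccontr)
  assume nz: "p \<noteq> 0"
  from assms(1) obtain c where "p = poly_const c" by (auto simp: constant_poly_def)
  then have "homogeneous_poly 0 p"
    using form_on_const[of UNIV c] by (simp add: form_on_def del: form_on_const)
  with nz assms(2,3) homogeneous_poly_unique show False by blast
qed

lemma expands_formula:
  fixes p :: "'a::field mpoly"
  assumes "expands V t N k p" "homogeneous_poly d p"
  obtains \<psi> :: "'a formula" where "SPaSP (nat \<lceil>k\<rceil>) t \<psi>" "homogeneous_formula \<psi>"
    "formula_vars \<psi> \<subseteq> V" "formula_poly \<psi> = p" "real (fan_in \<psi>) \<le> N"
proof -
  obtain ts where ts: "real (length ts) \<le> N" "p = sum_list (map prod_list ts)"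
    "\<And>qs. qs \<in> set ts \<Longrightarrow> k \<le> real (length qs)"
    "\<And>qs q. qs \<in> set ts \<Longrightarrow> q \<in> set qs \<Longrightarrow> \<exists>e. 0 < e \<and> e < t \<and> form_on V e q"
    using assms(1) unfolding expands_def by blast
  \<comment> \<open>A factor \<open>0\<close> is a constant polynomial and would not count towards
    the fan-in, so products containing it are dropped. The remaining factors are nonzero forms of
    positive degree, hence non-constant.\<close>
  let ?us = "filter (\<lambda>qs. 0 \<notin> set qs) ts"
  let ?P = "\<lambda>qs. Mul (map sparse_formula qs) :: 'a formula"
  let ?\<psi> = "Add (map ?P ?us)"
  have "sum_list (map prod_list (filter (\<lambda>qs. 0 \<in> set qs) ts)) =
      sum_list (map (\<lambda>qs. 0) (filter (\<lambda>qs. 0 \<in> set qs) ts))"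
    using prod_list_eq_0 by (intro arg_cong[where f = sum_list] map_cong) auto
  then have p: "p = sum_list (map prod_list ?us)"
    unfolding ts(2) by (subst sum_list_filter_split[of _ _ "\<lambda>qs. 0 \<in> set qs"]) simp
  have poly: "formula_poly ?\<psi> = p"
    by (simp add: p comp_def)
  show thesis
  proof (rule that[of ?\<psi>])
    show "formula_poly ?\<psi> = p" by (rule poly)
    have "fan_in ?\<psi> \<le> length ts" by (simp add: fan_in_def)
    with ts(1) show "real (fan_in ?\<psi>) \<le> N" by linarith
    have "formula_vars (sparse_formula q) \<subseteq> V" if "qs \<in> set ts" "q \<in> set qs" for qs q
      using ts(4)[OF that] formula_vars_sparse[of q] by (auto simp: form_on_def)
    then show "formula_vars ?\<psi> \<subseteq> V" by fastforce
    have hq: "\<exists>e. homogeneous_poly e q" if "qs \<in> set ts" "q \<in> set qs" for qs q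
      using ts(4)[OF that] by (auto simp: form_on_def)
    have "homogeneous_formula (?P qs)" if "qs \<in> set ts" for qs
      using hq[OF that] homogeneous_prod_list[of qs] by (auto simp: comp_def intro: homogeneous_sparse_formula)
    moreover have "\<exists>e. homogeneous_poly e (sum_list (map formula_poly (map ?P ?us)))"
      using poly assms(2) by auto
    ultimately show "homogeneous_formula ?\<psi>"
      unfolding homogeneous_formula_simps(3) by auto
    \<comment> \<open>The strict inequality leaves room for the coefficient as one more input of the
      bottom gate.\<close>
    have mono: "length (mono_vars m) < t" if "qs \<in> set ts" "q \<in> set qs" "m \<in> Poly_Mapping.keys q" for qs q m
      using ts(4)[OF that(1,2)] that(3) by (auto simp: length_mono_vars form_on_def homogeneous_poly_def)
    have "SPSP t ?\<psi>"
      by (auto simp: SPSP_def sparse_formula_def monomial_formula_def keys_list fan_in_def Suc_le_eq mono)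
    moreover have "nat \<lceil>k\<rceil> \<le> length (filter (\<lambda>q. \<not> constant_poly (formula_poly q)) (map sparse_formula qs))"
      if "qs \<in> set ?us" for qs
    proof -
      have "\<not> constant_poly q" if "q \<in> set qs" for q
        using ts(4)[of qs q] \<open>qs \<in> set ?us\<close> that constant_poly_homogeneous[of q]
        by (auto simp: form_on_def)
      then have "filter (\<lambda>q. \<not> constant_poly q) qs = qs" by (simp add: filter_id_conv)
      with ts(3)[of qs] that show ?thesis
        by (simp add: filter_map comp_def nat_le_iff ceiling_le_iff)
    qed
    ultimately show "SPaSP (nat \<lceil>k\<rceil>) t ?\<psi>"
      by (auto simp: SPaSP_def)
  qed
qed

section \<open>The case \<open>t = 1\<close>: expansion into monomials\<close>

text \<open>At addition gates \<open>s ^ e + s' ^ e\<close> is at most \<open>(s + s') ^ e\<close>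
  once \<open>e\<close> is positive. For \<open>e = 0\<close> this fails, but then 1 is the only
  possible monomial.\<close>

lemma hcomp_card_keys: "hcomp V s e p \<Longrightarrow> card (Poly_Mapping.keys p) \<le> s ^ e"
proof (induction rule: hcomp.induct)
  case (zero s e)
  then show ?case by simp
next
  case (const s c)
  then show ?case by (simp add: poly_const_def)
next
  case (var s i)
  then show ?case by (simp add: poly_var_def)
next
  case (add s e p s' q)
  show ?case
  proof (cases "e = 0")
    case True
    have "Poly_Mapping.keys (p + q) \<subseteq> {0}"
    proof
      fix m assume "m \<in> Poly_Mapping.keys (p + q)"
      moreover have "form_on V e (p + q)"
        using add.hyps by (intro form_on_add hcomp_form_on)
      ultimately have "mono_degree m = 0"
        using True by (auto simp: form_on_def homogeneous_poly_def)
      then show "m \<in> {0}"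
        by (auto simp: mono_degree_def in_keys_iff intro: poly_mapping_eqI)
    qed
    then have "card (Poly_Mapping.keys (p + q)) \<le> card {0 :: nat \<Rightarrow>\<^sub>0 nat}"
      by (intro card_mono) auto
    with True show ?thesis by simp
  next
    case False
    then obtain k where k: "e = Suc k" by (cases e) auto
    have "card (Poly_Mapping.keys (p + q)) \<le> card (Poly_Mapping.keys p \<union> Poly_Mapping.keys q)"
      by (intro card_mono keys_add) auto
    also have "\<dots> \<le> s ^ e + s' ^ e"
      using add.IH card_Un_le by (meson add_mono order_trans)
    also have "\<dots> \<le> s * (s + s') ^ k + s' * (s + s') ^ k"
      unfolding k power_Suc by (intro add_mono mult_left_mono power_mono) auto
    also have "\<dots> = (s + s') ^ e"
      by (simp add: k algebra_simps)
    finally show ?thesis .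
  qed
next
  case (mult s e p s' e' q)
  have "Poly_Mapping.keys (p * q) \<subseteq> (\<lambda>(a, b). a + b) ` (Poly_Mapping.keys p \<times> Poly_Mapping.keys q)"
    using keys_mult[of p q] by auto
  then have "card (Poly_Mapping.keys (p * q)) \<le> card (Poly_Mapping.keys p \<times> Poly_Mapping.keys q)"
    by (meson card_image_le card_mono finite_SigmaI finite_imageI finite_keys order_trans)
  also have "\<dots> \<le> s ^ e * s' ^ e'"
    using mult.IH by (simp add: card_cartesian_product mult_mono)
  also have "\<dots> \<le> (s + s') ^ (e + e')"
    unfolding power_add by (intro mult_mono power_mono) auto
  finally show ?case .
qed

text \<open>A bottom gate of fan-in 1 holds a single variable or a single constant. Thus each
  occurrence of a variable becomes a factor of its own, and the coefficient becomes an additional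
  constant factor, which does not count towards \<open>a\<close>.\<close>

definition expanded_formula :: "'a::field mpoly \<Rightarrow> 'a formula" where
  "expanded_formula p = Add (map (\<lambda>m. Mul (Add [Mul [Const (Poly_Mapping.lookup p m)]] #
     map (\<lambda>i. Add [Mul [Var i]]) (mono_vars m))) (keys_list p))"

lemma formula_poly_expanded [simp]: "formula_poly (expanded_formula p) = p"
  by (simp add: expanded_formula_def comp_def prod_list_mono_vars poly_const_def mult_single
      sum_list_keys_list sum_single_keys)

lemma not_constant_poly_var: "\<not> constant_poly (poly_var i :: 'a::field mpoly)"
proof
  assume "constant_poly (poly_var i :: 'a mpoly)"
  then have "poly_var i = (0 :: 'a mpoly)"
    using form_on_var[of i UNIV] by (auto simp: form_on_def intro: constant_poly_homogeneous)
  then show False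
    by (metis poly_var_def keys_single keys_zero insert_not_empty zero_neq_one)
qed

lemma SPaSP_expanded:
  assumes "homogeneous_poly d p"
  shows "SPaSP d 1 (expanded_formula p)"
proof -
  have "length (mono_vars m) = d" if "m \<in> Poly_Mapping.keys p" for m
    using assms that by (auto simp: length_mono_vars homogeneous_poly_def)
  then show ?thesis
    by (auto simp: SPaSP_def SPSP_def expanded_formula_def fan_in_def keys_list filter_map comp_def
        not_constant_poly_var)
qed

lemma homogeneous_expanded_formula:
  assumes "homogeneous_poly d p"
  shows "homogeneous_formula (expanded_formula p)"
proof -
  let ?M = "\<lambda>m. Mul (Add [Mul [Const (Poly_Mapping.lookup p m)]] #
     map (\<lambda>i. Add [Mul [Var i]]) (mono_vars m)) :: 'a formula"
  have "homogeneous_poly d (formula_poly (expanded_formula p))" using assms by simp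
  moreover have "homogeneous_formula (?M m)" for m
  proof -
    have "formula_poly (?M m) = Poly_Mapping.single m (Poly_Mapping.lookup p m)"
      by (simp add: comp_def prod_list_mono_vars poly_const_def mult_single)
    then have "homogeneous_poly (mono_degree m) (formula_poly (?M m))"
      by (auto simp: homogeneous_poly_def)
    then show ?thesis
      using form_on_var[of _ UNIV] form_on_const[of UNIV]
      by (auto simp: form_on_def simp del: form_on_const One_nat_def)
  qed
  ultimately show ?thesis
    unfolding expanded_formula_def homogeneous_formula_simps(3) by auto
qed

lemma formula_vars_expanded: "formula_vars (expanded_formula p) \<subseteq> poly_vars p"
  using set_mono_vars by (fastforce simp: expanded_formula_def poly_vars_def keys_list)

theorem theorem3p2:
  fixes f :: "'a::field mpoly" and \<phi> :: "'a formula" and n d s t :: nat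
  assumes "poly_vars f \<subseteq> {..<n}"
    and "homogeneous_poly d f"
    and "formula_vars \<phi> \<subseteq> {..<n}"
    and "homogeneous_formula \<phi>"
    and "formula_poly \<phi> = f"
    and "formula_size \<phi> = s"
    and "0 < t" and "t \<le> d"
  shows "\<exists>(a::nat) (\<psi> :: 'a formula).
           real a > 1 / 10 * (real d / real t) * log 2 (real t) \<and>
           SPaSP a t \<psi> \<and>
           homogeneous_formula \<psi> \<and>
           formula_vars \<psi> \<subseteq> {..<n} \<and>
           formula_poly \<psi> = f \<and>
           real (fan_in \<psi>) \<le> real s powr (10 * (real d / real t))"
proof -
  have hc: "hcomp {..<n} s d f"
    using hcomp_formula[of \<phi> "{..<n}" d] assms by simp
  then have s: "1 \<le> s" by (rule hcomp_size_pos)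
  show ?thesis
  proof (cases "t = 1")
    \<comment> \<open>Here log t = 0, so any positive \<open>a\<close> suffices;
      \<open>a = d\<close> is taken.\<close>
    case True
    have "fan_in (expanded_formula f) = card (Poly_Mapping.keys f)"
      using distinct_card[OF keys_list(2)[of f]] by (simp add: expanded_formula_def fan_in_def keys_list)
    also have "\<dots> \<le> s ^ d" using hc by (rule hcomp_card_keys)
    finally have "real (fan_in (expanded_formula f)) \<le> real (s ^ d)" by simp
    also have "\<dots> = real s powr real d" using s by (simp add: powr_realpow)
    also have "\<dots> \<le> real s powr (10 * (real d / real t))"
      using s True by (intro powr_mono) auto
    finally have "real (fan_in (expanded_formula f)) \<le> real s powr (10 * (real d / real t))" .
    with True assms show ?thesis
      using SPaSP_expanded homogeneous_expanded_formula formula_vars_expanded[of f]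
      by (intro exI[of _ d] exI[of _ "expanded_formula f"]) auto
  next
    case False
    with assms have t: "2 \<le> t" "0 < d" by auto
    obtain k where k: "factor_bound t d \<le> k"
      "expands {..<n} t (real s powr term_exp t d) k f"
      using hcomp_expands[OF hc t] assms(8) by blast
    obtain \<psi> :: "'a formula" where \<psi>: "SPaSP (nat \<lceil>k\<rceil>) t \<psi>" "homogeneous_formula \<psi>"
      "formula_vars \<psi> \<subseteq> {..<n}" "formula_poly \<psi> = f" "real (fan_in \<psi>) \<le> real s powr term_exp t d"
      using expands_formula[OF k(2) assms(2)] .
    have "0 \<le> log 2 (real t)" using t by simp
    \<comment> \<open>The coefficient 1/6 of the logarithm on the right exceeds 1/10, and the
      summand 1/3 makes the inequality strict.\<close>
    then have "1 / 10 * log 2 (real t) < 1 / 3 * (1 + log 2 (real t) / 2)"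
      by (simp add: field_simps)
    then have "real d / real t * (1 / 10 * log 2 (real t)) <
        real d / real t * (1 / 3 * (1 + log 2 (real t) / 2))"
      using t by (intro mult_strict_left_mono) auto
    then have "1 / 10 * (real d / real t) * log 2 (real t) < factor_bound t d"
      by (simp add: factor_bound_def algebra_simps)
    also have "\<dots> \<le> real (nat \<lceil>k\<rceil>)"
      using k(1) by linarith
    finally have a: "1 / 10 * (real d / real t) * log 2 (real t) < real (nat \<lceil>k\<rceil>)" .
    have "term_exp t d \<le> 10 * (real d / real t)"
      using t assms(8) by (simp add: term_exp_def field_simps)
    then have "real s powr term_exp t d \<le> real s powr (10 * (real d / real t))"
      using s by (intro powr_mono) auto
    with \<psi> a show ?thesis
      by (intro exI[of _ "nat \<lceil>k\<rceil>"] exI[of _ \<psi>]) auto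
  qed
qed

end
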